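(* Let $G$ be a connected graph of order $n$ with Laplacian matching roots $\lambda_1\ge\lambda_2\ge\cdots\ge\lambda_n$, and let $v_i,v_j$ be two nonadjacent vertices of $G$; put $e=v_iv_j$. Suppose there is an index $k\in\{2,\ldots,n\}$ such that the multiset of Laplacian matching roots of $G+e$ is $\{\lambda_1+1,\lambda_k+1\}\cup\{\lambda_\ell:\ \ell\neq 1,k\}$. Then, with $d(\cdot)$ denoting degrees in $G$, $$\lambda_1+\lambda_k=d(v_i)+d(v_j)+1,\qquad \lambda_1\lambda_k=d(v_i)d(v_j).$$
   Context: All graphs are finite, simple and undirected. For a graph $G$, $d(v)$ is the degree of $v$ and $\mathcal{M}(G)$ the set of matchings of $G$ (including the empty one); $V(M)$ is the set of endpoints of edges of a matching $M$. The Laplacian matching polynomial is $\mathscr{LM}(G,x)=\sum_{M\in\mathcal{M}(G)}(-1)^{|M|}\prod_{v\in V(G)\setminus V(M)}(x-d(v))$; its roots are real and nonnegative and are called the Laplacian matching roots, listed with multiplicity in nonincreasing order. $G+e$ is $G$ with the new edge $e$ added. *)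

theory Defs
  imports "HOL-Computational_Algebra.Polynomial" "HOL-Library.Multiset"
begin

definition simple_graph :: "'a set \<Rightarrow> 'a set set \<Rightarrow> bool" where
  "simple_graph V E \<longleftrightarrow> finite V \<and> (\<forall>e\<in>E. e \<subseteq> V \<and> card e = 2)"

definition graph_connected :: "'a set \<Rightarrow> 'a set set \<Rightarrow> bool" where
  "graph_connected V E \<longleftrightarrow> V \<noteq> {} \<and> (\<forall>u\<in>V. \<forall>v\<in>V. (u, v) \<in> {(x, y). {x, y} \<in> E}\<^sup>*)"

definition vdeg :: "'a set set \<Rightarrow> 'a \<Rightarrow> nat" where
  "vdeg E v = card {e \<in> E. v \<in> e}"

definition matchings :: "'a set set \<Rightarrow> 'a set set set" where
  "matchings E = {M. M \<subseteq> E \<and> pairwise disjnt M}"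

definition laplacian_matching_poly :: "'a set \<Rightarrow> 'a set set \<Rightarrow> real poly" where
  "laplacian_matching_poly V E =
     (\<Sum>M\<in>matchings E. (- 1) ^ card M * (\<Prod>v\<in>V - \<Union>M. [:- real (vdeg E v), 1:]))"

text \<open>The multiset of real roots. Real-rootedness makes this the multiset of all complex roots.\<close>

definition laplacian_matching_roots :: "'a set \<Rightarrow> 'a set set \<Rightarrow> real multiset" where
  "laplacian_matching_roots V E = proots (laplacian_matching_poly V E)"

end

theory Submission
  imports Defs "HOL-Computational_Algebra.Polynomial_FPS"
begin

text \<open>
  By Newton's identities the first three power sums of the Laplacian matching roots depend only on
  the top four coefficients of the polynomial, to which only matchings with at most one edge
  contribute. The second and third power sums equal \<open>\<Sum>d(v)\<^sup>2 + \<Sum>d(v)\<close> and \<open>\<Sum>d(v)\<^sup>3 + 3 \<Sum>d(v)\<^sup>2\<close>.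
  Comparing them before and after adding the edge determines \<open>\<lambda>\<^sub>1 + \<lambda>\<^sub>k\<close> and then
  \<open>\<lambda>\<^sub>1\<^sup>2 + \<lambda>\<^sub>k\<^sup>2\<close>.
\<close>

section \<open>Polynomials with prescribed roots and Newton's identities\<close>

definition power_sum :: "nat \<Rightarrow> 'a::comm_semiring_1 multiset \<Rightarrow> 'a" where
  "power_sum j A = (\<Sum>x\<in>#A. x ^ j)"

definition root_poly :: "'a::comm_ring_1 multiset \<Rightarrow> 'a poly" where
  "root_poly A = (\<Prod>x\<in>#A. [:- x, 1:])"

definition reciprocal_root_poly :: "'a::comm_ring_1 multiset \<Rightarrow> 'a poly" where
  "reciprocal_root_poly A = (\<Prod>x\<in>#A. [:1, - x:])"

lemma power_sum_add_mset [simp]: "power_sum j (add_mset x A) = x ^ j + power_sum j A"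
  by (simp add: power_sum_def)

lemma root_poly_empty [simp]: "root_poly {#} = 1"
  by (simp add: root_poly_def)

lemma root_poly_add_mset [simp]: "root_poly (add_mset x A) = [:- x, 1:] * root_poly A"
  unfolding root_poly_def by (simp only: image_mset_add_mset prod_mset.add_mset)

lemma root_poly_union: "root_poly (A + B) = root_poly A * root_poly B"
  by (simp add: root_poly_def)

lemma root_poly_replicate_mset: "root_poly (replicate_mset n x) = [:- x, 1:] ^ n"
  by (simp add: root_poly_def)

lemma reciprocal_root_poly_empty [simp]: "reciprocal_root_poly {#} = 1"
  by (simp add: reciprocal_root_poly_def)

lemma reciprocal_root_poly_add_mset [simp]:
  "reciprocal_root_poly (add_mset x A) = [:1, - x:] * reciprocal_root_poly A"
  unfolding reciprocal_root_poly_def by (simp only: image_mset_add_mset prod_mset.add_mset)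

lemma coeff_0_reciprocal_root_poly [simp]: "coeff (reciprocal_root_poly A) 0 = 1"
  by (induction A) (simp_all add: coeff_mult_0)

lemma lead_coeff_root_poly:
  fixes A :: "'a::idom multiset"
  shows "lead_coeff (root_poly A) = 1"
proof (induction A)
  case (add x A)
  then show ?case
    unfolding root_poly_add_mset by (subst lead_coeff_mult) simp
qed simp

lemma degree_root_poly [simp]:
  fixes A :: "'a::idom multiset"
  shows "degree (root_poly A) = size A"
proof (induction A)
  case (add x A)
  have "root_poly A \<noteq> 0"
    using lead_coeff_root_poly[of A] by (metis leading_coeff_0_iff zero_neq_one)
  then have "degree (root_poly (add_mset x A)) = Suc (degree (root_poly A))"
    unfolding root_poly_add_mset by (subst degree_mult_eq) simp_all
  with add show ?case by simp
qed simp

lemma reflect_root_poly: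
  fixes A :: "'a::idom multiset"
  shows "reflect_poly (root_poly A) = reciprocal_root_poly A"
proof (induction A)
  case (add x A)
  have "reflect_poly [:- x, 1:] = [:1, - x:]"
    by (simp add: reflect_poly_def)
  with add show ?case
    by (simp only: root_poly_add_mset reciprocal_root_poly_add_mset reflect_poly_mult)
qed simp

lemma root_poly_proots_dvd:
  fixes p :: "'a::idom poly"
  shows "root_poly (proots p) dvd p"
proof (induction p rule: poly_root_order_induct)
  case (no_roots p)
  then have "proots p = {#}"
    by (simp add: multiset_eqI order_root)
  then show ?case by simp
next
  case (root p x n)
  then have "p \<noteq> 0" by auto
  then have "proots ([:- x, 1:] ^ n * p) = replicate_mset n x + proots p"
    by (simp add: proots_mult proots_power)
  with root.IH show ?case
    by (simp add: root_poly_union root_poly_replicate_mset)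
qed simp

lemma monic_eq_root_poly_proots:
  fixes p :: "'a::idom poly"
  assumes "lead_coeff p = 1" "size (proots p) = degree p"
  shows "p = root_poly (proots p)"
proof -
  obtain q where factor: "p = root_poly (proots p) * q"
    using root_poly_proots_dvd by (rule dvdE)
  have "p \<noteq> 0" using assms(1) by auto
  with factor have "degree p = size (proots p) + degree q"
    by (metis degree_mult_eq degree_root_poly mult_zero_left mult_zero_right)
  with assms(2) obtain c where "q = [:c:]"
    by (auto elim: degree_eq_zeroE)
  moreover have "lead_coeff q = 1"
    using factor assms(1) by (metis lead_coeff_mult lead_coeff_root_poly mult_1)
  ultimately have "q = 1" by simp
  with factor show ?thesis by simp
qed

lemma one_minus_const_fps_X_mult_geometric:
  fixes c :: "'a::comm_ring_1"
  shows "(1 - fps_const c * fps_X) * Abs_fps (\<lambda>n. c ^ n) = 1"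
proof (rule fps_ext)
  fix n
  show "fps_nth ((1 - fps_const c * fps_X) * Abs_fps (\<lambda>n. c ^ n)) n = fps_nth 1 n"
    by (cases n) (simp_all add: left_diff_distrib mult.assoc)
qed

lemma fps_deriv_reciprocal_root_poly:
  fixes A :: "'a::comm_ring_1 multiset"
  shows "fps_deriv (fps_of_poly (reciprocal_root_poly A)) =
    - fps_of_poly (reciprocal_root_poly A) * Abs_fps (\<lambda>n. power_sum (Suc n) A)"
proof (induction A)
  case empty
  show ?case by (simp add: power_sum_def fps_eq_iff)
next
  case (add y A)
  define f where "f = fps_of_poly (reciprocal_root_poly A)"
  define P where "P = Abs_fps (\<lambda>n. power_sum (Suc n) A)"
  let ?linear = "1 - fps_const y * fps_X"
  let ?geometric = "Abs_fps (\<lambda>n. y ^ n)"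
  have factor: "fps_of_poly (reciprocal_root_poly (add_mset y A)) = ?linear * f"
    by (simp add: f_def fps_of_poly_mult fps_of_poly_pCons fps_of_poly_uminus algebra_simps
        flip: fps_const_neg)
  have series: "Abs_fps (\<lambda>n. power_sum (Suc n) (add_mset y A)) = P + fps_const y * ?geometric"
    by (simp add: P_def fps_eq_iff add.commute)
  have "fps_deriv (?linear * f) = - (fps_const y * f) - ?linear * f * P"
    using add.IH by (simp add: f_def P_def algebra_simps)
  also have "\<dots> = - (fps_const y * f * (?linear * ?geometric)) - ?linear * f * P"
    by (simp only: one_minus_const_fps_X_mult_geometric mult_1_right)
  also have "\<dots> = - (?linear * f) * (P + fps_const y * ?geometric)"
    by (simp add: algebra_simps)
  finally show ?case
    unfolding factor series .
qed

lemma newton_identity: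
  fixes A :: "'a::comm_ring_1 multiset"
  shows "of_nat (Suc n) * coeff (reciprocal_root_poly A) (Suc n) =
    - (\<Sum>i\<le>n. coeff (reciprocal_root_poly A) i * power_sum (Suc (n - i)) A)"
  using arg_cong[OF fps_deriv_reciprocal_root_poly, of "\<lambda>f. fps_nth f n" A]
  by (simp add: fps_mult_nth sum_negf atLeast0AtMost)

lemma power_sum_eq_coeff_reciprocal_root_poly:
  fixes A :: "'a::comm_ring_1 multiset"
  defines "c \<equiv> coeff (reciprocal_root_poly A)"
  shows "power_sum 1 A = - c 1"
    and "power_sum 2 A = c 1 ^ 2 - 2 * c 2"
    and "power_sum 3 A = 3 * c 1 * c 2 - c 1 ^ 3 - 3 * c 3"
proof -
  show power_sum_1: "power_sum 1 A = - c 1"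
    using newton_identity[of 0 A] by (simp add: c_def)
  have "2 * c 2 = - power_sum 2 A - c 1 * power_sum 1 A"
    using newton_identity[of 1 A] by (simp add: c_def numeral_2_eq_2)
  then show power_sum_2: "power_sum 2 A = c 1 ^ 2 - 2 * c 2"
    unfolding power_sum_1 by (simp add: power2_eq_square)
  have "3 * c 3 = - power_sum 3 A - c 1 * power_sum 2 A - c 2 * power_sum 1 A"
    using newton_identity[of 2 A] by (simp add: c_def numeral_3_eq_3 numeral_2_eq_2)
  then show "power_sum 3 A = 3 * c 1 * c 2 - c 1 ^ 3 - 3 * c 3"
    unfolding power_sum_1 power_sum_2 by (simp add: power2_eq_square power3_eq_cube algebra_simps)
qed

lemma reflect_poly_sum:
  fixes f :: "'a \<Rightarrow> 'b::comm_semiring_1 poly"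
  assumes "\<And>a. a \<in> A \<Longrightarrow> degree (f a) \<le> degree (sum f A)"
  shows "reflect_poly (sum f A) =
    (\<Sum>a\<in>A. monom 1 (degree (sum f A) - degree (f a)) * reflect_poly (f a))"
proof (rule poly_eqI)
  fix i
  let ?d = "degree (sum f A)"
  have "coeff (monom 1 (?d - degree (f a)) * reflect_poly (f a)) i =
      (if ?d < i then 0 else coeff (f a) (?d - i))" if "a \<in> A" for a
    using assms[OF that] by (auto simp: coeff_monom_mult coeff_reflect_poly coeff_eq_0)
  then show "coeff (reflect_poly (sum f A)) i =
      coeff (\<Sum>a\<in>A. monom 1 (?d - degree (f a)) * reflect_poly (f a)) i"
    by (simp add: coeff_reflect_poly coeff_sum)
qed

section \<open>Degrees and matchings\<close>

definition degree_mset :: "'a set set \<Rightarrow> 'a set \<Rightarrow> real multiset" where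
  "degree_mset E S = {#real (vdeg E v). v \<in># mset_set S#}"

lemma size_degree_mset [simp]: "size (degree_mset E S) = card S"
  by (simp add: degree_mset_def)

lemma power_sum_degree_mset: "power_sum j (degree_mset E S) = (\<Sum>v\<in>S. real (vdeg E v) ^ j)"
  by (simp add: power_sum_def degree_mset_def sum_unfold_sum_mset image_mset.compositionality comp_def)

lemma mset_set_remove_pair:
  assumes "finite S" "u \<in> S" "v \<in> S" "u \<noteq> v"
  shows "mset_set S = {#u, v#} + mset_set (S - {u, v})"
  using assms
  by (simp add: mset_set.remove[of S u] mset_set.remove[of "S - {u}" v] Diff_insert2[of S u "{v}"])

lemma degree_mset_remove_pair:
  assumes "finite S" "u \<in> S" "v \<in> S" "u \<noteq> v"
  shows "degree_mset E S = {#real (vdeg E u), real (vdeg E v)#} + degree_mset E (S - {u, v})"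
  by (simp add: degree_mset_def mset_set_remove_pair[OF assms])

lemma vdeg_insert_edge:
  assumes "finite E" "e \<notin> E"
  shows "vdeg (insert e E) v = (if v \<in> e then Suc (vdeg E v) else vdeg E v)"
proof -
  have "{f \<in> insert e E. v \<in> f} = (if v \<in> e then insert e {f \<in> E. v \<in> f} else {f \<in> E. v \<in> f})"
    by auto
  then show ?thesis using assms by (simp add: vdeg_def)
qed

lemma degree_mset_insert_edge:
  assumes "finite S" "finite E" "u \<in> S" "v \<in> S" "u \<noteq> v" "{u, v} \<notin> E"
  shows "degree_mset (insert {u, v} E) S =
    {#real (vdeg E u) + 1, real (vdeg E v) + 1#} + degree_mset E (S - {u, v})"
proof -
  have "degree_mset (insert {u, v} E) (S - {u, v}) = degree_mset E (S - {u, v})"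
    unfolding degree_mset_def using assms by (intro image_mset_cong) (simp add: vdeg_insert_edge)
  then show ?thesis
    using assms by (simp add: degree_mset_remove_pair[of S u v] vdeg_insert_edge add.commute)
qed

lemma simple_graph_finite_vertices: "simple_graph V E \<Longrightarrow> finite V"
  by (simp add: simple_graph_def)

lemma simple_graph_finite_edges:
  assumes "simple_graph V E"
  shows "finite E"
  using assms finite_subset[of E "Pow V"] by (auto simp: simple_graph_def)

lemma sum_edges_eq_sum_vdeg:
  fixes g :: "'a \<Rightarrow> 'b::semiring_1"
  assumes "simple_graph V E"
  shows "(\<Sum>e\<in>E. \<Sum>v\<in>e. g v) = (\<Sum>v\<in>V. of_nat (vdeg E v) * g v)"
proof -
  have "(\<Sum>e\<in>E. \<Sum>v\<in>e. g v) = (\<Sum>e\<in>E. \<Sum>v | v \<in> V \<and> v \<in> e. g v)"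
    using assms by (intro sum.cong) (auto simp: simple_graph_def)
  also have "\<dots> = (\<Sum>v\<in>V. \<Sum>e | e \<in> E \<and> v \<in> e. g v)"
    using simple_graph_finite_edges[OF assms] simple_graph_finite_vertices[OF assms]
    by (rule sum.swap_restrict)
  finally show ?thesis by (simp add: vdeg_def)
qed

lemma sum_vdeg_eq_twice_card_edges:
  assumes "simple_graph V E"
  shows "(\<Sum>v\<in>V. vdeg E v) = 2 * card E"
  using sum_edges_eq_sum_vdeg[OF assms, of "\<lambda>_. 1 :: nat"] assms
  by (simp add: simple_graph_def)

lemma finite_matchings: "finite E \<Longrightarrow> finite (matchings E)"
  by (rule finite_subset[of _ "Pow E"]) (auto simp: matchings_def)

lemma finite_matching: "finite E \<Longrightarrow> M \<in> matchings E \<Longrightarrow> finite M"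
  by (auto simp: matchings_def intro: finite_subset)

lemma empty_in_matchings: "{} \<in> matchings E"
  by (simp add: matchings_def)

lemma matchings_card_le_1:
  assumes "finite E"
  shows "{M \<in> matchings E. card M \<le> 1} = insert {} ((\<lambda>e. {e}) ` E)"
proof (intro equalityI subsetI)
  fix M assume small: "M \<in> {M \<in> matchings E. card M \<le> 1}"
  then consider "card M = 0" | "card M = 1" by fastforce
  then show "M \<in> insert {} ((\<lambda>e. {e}) ` E)"
    using small finite_matching[OF assms, of M]
    by cases (auto simp: matchings_def card_1_singleton_iff)
qed (auto simp: matchings_def)

lemma card_Union_matching:
  assumes "simple_graph V E" "M \<in> matchings E"
  shows "card (\<Union>M) = 2 * card M"
proof -
  have card_edge: "card e = 2" if "e \<in> M" for e
    using assms that by (auto simp: simple_graph_def matchings_def)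
  have "card (\<Union>M) = sum card M"
    using assms(2) card_edge by (intro card_Union_disjoint)
      (auto simp: matchings_def intro: card_ge_0_finite)
  with card_edge show ?thesis by simp
qed

lemma card_unmatched_vertices:
  assumes "simple_graph V E" "M \<in> matchings E"
  shows "card V = card (V - \<Union>M) + 2 * card M"
proof -
  have "\<Union>M \<subseteq> V" using assms by (auto simp: simple_graph_def matchings_def)
  then show ?thesis
    using card_Union_matching[OF assms] simple_graph_finite_vertices[OF assms(1)]
    by (metis add.commute card_Un_disjoint Diff_disjoint Diff_partition finite_Diff finite_subset)
qed

section \<open>The Laplacian matching polynomial\<close>

definition matching_term :: "'a set \<Rightarrow> 'a set set \<Rightarrow> 'a set set \<Rightarrow> real poly" where
  "matching_term V E M = smult ((- 1) ^ card M) (root_poly (degree_mset E (V - \<Union>M)))"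

lemma laplacian_matching_poly_eq_sum_matching_term:
  "laplacian_matching_poly V E = (\<Sum>M\<in>matchings E. matching_term V E M)"
proof -
  have "(- 1) ^ card M * (\<Prod>v\<in>V - \<Union>M. [:- real (vdeg E v), 1:]) = matching_term V E M" for M
    by (cases "even (card M)")
      (simp_all add: matching_term_def root_poly_def degree_mset_def prod_unfold_prod_mset
        image_mset.compositionality comp_def)
  then show ?thesis by (simp add: laplacian_matching_poly_def)
qed

lemma degree_matching_term: "degree (matching_term V E M) = card (V - \<Union>M)"
  by (simp add: matching_term_def)

lemma reflect_matching_term:
  "reflect_poly (matching_term V E M) =
    smult ((- 1) ^ card M) (reciprocal_root_poly (degree_mset E (V - \<Union>M)))"
  by (simp add: matching_term_def reflect_poly_smult reflect_root_poly)

lemma coeff_card_laplacian_matching_poly: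
  assumes "simple_graph V E"
  shows "coeff (laplacian_matching_poly V E) (card V) = 1"
proof -
  have finite_E: "finite E" by (rule simple_graph_finite_edges[OF assms])
  have "coeff (matching_term V E M) (card V) = 0" if nonempty: "M \<in> matchings E - {{}}" for M
  proof -
    have "card M > 0"
      using nonempty finite_matching[OF finite_E] by (auto simp: card_gt_0_iff)
    then have "degree (matching_term V E M) < card V"
      using nonempty card_unmatched_vertices[OF assms, of M] by (simp add: degree_matching_term)
    then show ?thesis by (rule coeff_eq_0)
  qed
  then have "coeff (laplacian_matching_poly V E) (card V) =
      (\<Sum>M\<in>{{}}. coeff (matching_term V E M) (card V))"
    unfolding laplacian_matching_poly_eq_sum_matching_term coeff_sum
    using finite_matchings[OF finite_E] empty_in_matchings by (intro sum.mono_neutral_right) auto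
  also have "\<dots> = 1"
    using lead_coeff_root_poly[of "degree_mset E V"] by (simp add: matching_term_def)
  finally show ?thesis .
qed

lemma degree_laplacian_matching_poly:
  assumes "simple_graph V E"
  shows "degree (laplacian_matching_poly V E) = card V"
proof (rule antisym)
  have "degree (matching_term V E M) \<le> card V" for M
    unfolding degree_matching_term
    using simple_graph_finite_vertices[OF assms] by (intro card_mono) auto
  then show "degree (laplacian_matching_poly V E) \<le> card V"
    unfolding laplacian_matching_poly_eq_sum_matching_term
    using finite_matchings[OF simple_graph_finite_edges[OF assms]] by (intro degree_sum_le)
  show "card V \<le> degree (laplacian_matching_poly V E)"
    using coeff_card_laplacian_matching_poly[OF assms] by (intro le_degree) simp
qed

lemma reflect_laplacian_matching_poly:
  assumes "simple_graph V E"
  shows "reflect_poly (laplacian_matching_poly V E) =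
    (\<Sum>M\<in>matchings E. monom 1 (2 * card M) *
      smult ((- 1) ^ card M) (reciprocal_root_poly (degree_mset E (V - \<Union>M))))"
proof -
  note degree_sum = degree_laplacian_matching_poly[OF assms,
      unfolded laplacian_matching_poly_eq_sum_matching_term]
  have unmatched: "card V = card (V - \<Union>M) + 2 * card M" if "M \<in> matchings E" for M
    using assms that by (rule card_unmatched_vertices)
  then have "reflect_poly (laplacian_matching_poly V E) =
      (\<Sum>M\<in>matchings E. monom 1 (card V - card (V - \<Union>M)) * reflect_poly (matching_term V E M))"
    unfolding laplacian_matching_poly_eq_sum_matching_term
    by (subst reflect_poly_sum) (simp_all add: degree_sum degree_matching_term)
  also have "\<dots> = (\<Sum>M\<in>matchings E. monom 1 (2 * card M) *
      smult ((- 1) ^ card M) (reciprocal_root_poly (degree_mset E (V - \<Union>M))))"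
    unfolding reflect_matching_term using unmatched by (intro sum.cong) simp_all
  finally show ?thesis .
qed

lemma coeff_reflect_laplacian_matching_poly:
  assumes "simple_graph V E" "i < 4"
  shows "coeff (reflect_poly (laplacian_matching_poly V E)) i =
    coeff (reciprocal_root_poly (degree_mset E V)
      - monom 1 2 * (\<Sum>e\<in>E. reciprocal_root_poly (degree_mset E (V - e)))) i"
proof -
  define T where "T M = monom 1 (2 * card M) *
    smult ((- 1) ^ card M) (reciprocal_root_poly (degree_mset E (V - \<Union>M)))" for M
  have finite_E: "finite E" by (rule simple_graph_finite_edges[OF assms(1)])
  have "coeff (reflect_poly (laplacian_matching_poly V E)) i = (\<Sum>M\<in>matchings E. coeff (T M) i)"
    by (simp only: reflect_laplacian_matching_poly[OF assms(1)] T_def coeff_sum)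
  also have "\<dots> = (\<Sum>M | M \<in> matchings E \<and> card M \<le> 1. coeff (T M) i)"
    using finite_matchings[OF finite_E] assms(2)
    by (intro sum.mono_neutral_right) (auto simp: T_def coeff_monom_mult)
  also have "\<dots> = coeff (T {} + (\<Sum>e\<in>E. T {e})) i"
    unfolding matchings_card_le_1[OF finite_E] coeff_add coeff_sum
    using finite_E by (subst sum.insert) (auto simp: sum.reindex inj_on_def)
  also have "T {} + (\<Sum>e\<in>E. T {e}) = reciprocal_root_poly (degree_mset E V)
      - monom 1 2 * (\<Sum>e\<in>E. reciprocal_root_poly (degree_mset E (V - e)))"
    by (simp add: T_def sum_distrib_left sum_negf)
  finally show ?thesis .
qed

lemma reflect_laplacian_matching_poly_eq_reciprocal_root_poly:
  assumes "simple_graph V E" "size (laplacian_matching_roots V E) = card V"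
  shows "reflect_poly (laplacian_matching_poly V E) =
    reciprocal_root_poly (laplacian_matching_roots V E)"
proof -
  have "laplacian_matching_poly V E = root_poly (laplacian_matching_roots V E)"
    using assms unfolding laplacian_matching_roots_def
    by (intro monic_eq_root_poly_proots)
      (simp_all add: degree_laplacian_matching_poly coeff_card_laplacian_matching_poly)
  then show ?thesis by (simp add: reflect_root_poly)
qed

lemma sum_edges_coeff_1_reciprocal_root_poly:
  assumes "simple_graph V E"
  shows "(\<Sum>e\<in>E. coeff (reciprocal_root_poly (degree_mset E (V - e))) 1) =
    power_sum 2 (degree_mset E V) - real (card E) * power_sum 1 (degree_mset E V)"
proof -
  have "coeff (reciprocal_root_poly (degree_mset E (V - e))) 1 =
      (\<Sum>v\<in>e. real (vdeg E v)) - power_sum 1 (degree_mset E V)" if "e \<in> E" for e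
  proof -
    have "e \<subseteq> V" using assms that by (simp add: simple_graph_def)
    moreover have "coeff (reciprocal_root_poly (degree_mset E (V - e))) 1 =
        - (\<Sum>v\<in>V - e. real (vdeg E v))"
      using power_sum_eq_coeff_reciprocal_root_poly(1)[of "degree_mset E (V - e)"]
      by (simp add: power_sum_degree_mset)
    ultimately show ?thesis
      using simple_graph_finite_vertices[OF assms] by (simp add: power_sum_degree_mset sum_diff)
  qed
  then have "(\<Sum>e\<in>E. coeff (reciprocal_root_poly (degree_mset E (V - e))) 1) =
      (\<Sum>e\<in>E. \<Sum>v\<in>e. real (vdeg E v)) - real (card E) * power_sum 1 (degree_mset E V)"
    by (simp add: sum_subtractf)
  also have "(\<Sum>e\<in>E. \<Sum>v\<in>e. real (vdeg E v)) = power_sum 2 (degree_mset E V)"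
    by (simp add: sum_edges_eq_sum_vdeg[OF assms] power_sum_degree_mset power2_eq_square)
  finally show ?thesis .
qed

lemma power_sum_laplacian_matching_roots:
  assumes "simple_graph V E" "size (laplacian_matching_roots V E) = card V"
  shows "power_sum 2 (laplacian_matching_roots V E) =
      power_sum 2 (degree_mset E V) + power_sum 1 (degree_mset E V)"
    and "power_sum 3 (laplacian_matching_roots V E) =
      power_sum 3 (degree_mset E V) + 3 * power_sum 2 (degree_mset E V)"
proof -
  define c where "c = coeff (reciprocal_root_poly (laplacian_matching_roots V E))"
  define d where "d = coeff (reciprocal_root_poly (degree_mset E V))"
  note expansion = coeff_reflect_laplacian_matching_poly[OF assms(1),
      unfolded reflect_laplacian_matching_poly_eq_reciprocal_root_poly[OF assms], folded c_def]
  have coeff_1: "c 1 = d 1"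
    using expansion[of 1] by (simp add: coeff_monom_mult d_def)
  have coeff_2: "c 2 = d 2 - real (card E)"
    using expansion[of 2] by (simp add: coeff_monom_mult coeff_sum d_def)
  have coeff_3: "c 3 = d 3 -
      (power_sum 2 (degree_mset E V) - real (card E) * power_sum 1 (degree_mset E V))"
    using expansion[of 3] sum_edges_coeff_1_reciprocal_root_poly[OF assms(1)]
    by (simp add: coeff_monom_mult coeff_sum d_def)
  have handshake: "power_sum 1 (degree_mset E V) = 2 * real (card E)"
    using sum_vdeg_eq_twice_card_edges[OF assms(1)]
    by (simp add: power_sum_degree_mset flip: of_nat_sum)
  note root_sums = power_sum_eq_coeff_reciprocal_root_poly[of "laplacian_matching_roots V E", folded c_def]
  note degree_sums = power_sum_eq_coeff_reciprocal_root_poly[of "degree_mset E V", folded d_def]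
  show "power_sum 2 (laplacian_matching_roots V E) =
      power_sum 2 (degree_mset E V) + power_sum 1 (degree_mset E V)"
    using root_sums(2) degree_sums(2) coeff_1 coeff_2 handshake by simp
  show "power_sum 3 (laplacian_matching_roots V E) =
      power_sum 3 (degree_mset E V) + 3 * power_sum 2 (degree_mset E V)"
    using root_sums(3) degree_sums(1,3) coeff_1 coeff_2 coeff_3 by algebra
qed

lemma sum_and_product_of_roots_shifted_by_edge:
  assumes graph: "simple_graph V E" and edge: "u \<in> V" "v \<in> V" "u \<noteq> v" "{u, v} \<notin> E"
    and real_rooted: "size (laplacian_matching_roots V E) = card V"
    and roots: "laplacian_matching_roots V E = {#a, b#} + R"
    and shifted: "laplacian_matching_roots V (insert {u, v} E) = {#a + 1, b + 1#} + R"
  defines "x \<equiv> real (vdeg E u)" and "y \<equiv> real (vdeg E v)"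
  shows "a + b = x + y + 1" and "a * b = x * y"
proof -
  have graph': "simple_graph V (insert {u, v} E)"
    using graph edge by (simp add: simple_graph_def)
  have real_rooted': "size (laplacian_matching_roots V (insert {u, v} E)) = card V"
    using real_rooted roots shifted by simp
  have degrees: "degree_mset E V = {#x, y#} + degree_mset E (V - {u, v})"
    using simple_graph_finite_vertices[OF graph] edge
    unfolding x_def y_def by (intro degree_mset_remove_pair)
  have degrees': "degree_mset (insert {u, v} E) V = {#x + 1, y + 1#} + degree_mset E (V - {u, v})"
    using simple_graph_finite_vertices[OF graph] simple_graph_finite_edges[OF graph] edge
    unfolding x_def y_def by (intro degree_mset_insert_edge)
  note sums = power_sum_laplacian_matching_roots[OF graph real_rooted, unfolded roots degrees]
  note sums' = power_sum_laplacian_matching_roots[OF graph' real_rooted', unfolded shifted degrees']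
  show sum: "a + b = x + y + 1"
    using sums(1) sums'(1) by (simp add: power2_eq_square algebra_simps)
  have "a\<^sup>2 + b\<^sup>2 + (a + b) = x\<^sup>2 + y\<^sup>2 + 3 * (x + y) + 2"
    using sums(2) sums'(2) by (simp add: power2_eq_square power3_eq_cube algebra_simps)
  with sum have "2 * (a * b) = 2 * (x * y)" by algebra
  then show "a * b = x * y" by simp
qed

theorem theorem3p2:
  fixes V :: "'a set" and E :: "'a set set" and n k :: nat
    and lam :: "nat \<Rightarrow> real" and vi vj :: 'a
  assumes "simple_graph V E" and "graph_connected V E" and "card V = n"
    and "\<And>r s. 1 \<le> r \<Longrightarrow> r \<le> s \<Longrightarrow> s \<le> n \<Longrightarrow> lam s \<le> lam r"
    and "laplacian_matching_roots V E = image_mset lam (mset_set {1..n})"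
    and "vi \<in> V" and "vj \<in> V" and "vi \<noteq> vj" and "{vi, vj} \<notin> E"
    and "k \<in> {2..n}"
    and "laplacian_matching_roots V (insert {vi, vj} E)
           = {#lam 1 + 1, lam k + 1#} + image_mset lam (mset_set ({1..n} - {1, k}))"
  shows "lam 1 + lam k = real (vdeg E vi) + real (vdeg E vj) + 1
       \<and> lam 1 * lam k = real (vdeg E vi) * real (vdeg E vj)"
proof -
  have "size (laplacian_matching_roots V E) = card V"
    using assms(3,5) by simp
  moreover have "mset_set {1..n} = {#1, k#} + mset_set ({1..n} - {1, k})"
    using assms(10) by (intro mset_set_remove_pair) auto
  then have "laplacian_matching_roots V E =
      {#lam 1, lam k#} + image_mset lam (mset_set ({1..n} - {1, k}))"
    by (simp add: assms(5))
  ultimately show ?thesis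
    using sum_and_product_of_roots_shifted_by_edge[OF assms(1,6-9) _ _ assms(11)] by blast
qed

end
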